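(* Let $q$ be a prime power and $m\ge1$. Let $X\subseteq\mathbb{F}_q^m$ be a set of $n$ vectors which span $\mathbb{F}_q^m$, and let $\mathscr{M}=(X,\mathcal I)$ be the corresponding matroid (independent sets are the linearly independent subsets of $X$), of rank $m$. Let $\mathrm I(j)$ be the number of independent sets of size $j$. Then for all $1\le k<m$, $$\mathrm I(k)^2\ \ge\ \Bigl(1+\frac1k\Bigr)\Bigl(1+\frac{1}{q^{m-k+1}-2}\Bigr)\,\mathrm I(k-1)\,\mathrm I(k+1).$$
   Context: $\mathbb F_q$ is the finite field with $q$ elements. *)

theory Defs
  imports "HOL-Analysis.Analysis"
begin

text \<open>A finite matroid is given as a pair (ground set, family of independent sets).\<close>

type_synonym 'e matroid = "'e set \<times> 'e set set"

definition is_matroid :: "'e matroid \<Rightarrow> bool" where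
  "is_matroid M \<longleftrightarrow>
     finite (fst M) \<and> snd M \<subseteq> Pow (fst M) \<and> {} \<in> snd M \<and>
     (\<forall>S T. T \<in> snd M \<and> S \<subseteq> T \<longrightarrow> S \<in> snd M) \<and>
     (\<forall>S T. S \<in> snd M \<and> T \<in> snd M \<and> card S < card T \<longrightarrow> (\<exists>x \<in> T - S. insert x S \<in> snd M))"

definition matroid_rank :: "'e matroid \<Rightarrow> nat" where
  "matroid_rank M = Max (card ` snd M)"

definition num_indep :: "'e matroid \<Rightarrow> nat \<Rightarrow> nat" where
  "num_indep M j = card {S \<in> snd M. card S = j}"

definition linear_matroid :: "('a::field ^ 'm) set \<Rightarrow> ('a ^ 'm) matroid" where
  "linear_matroid X = (X, {S. S \<subseteq> X \<and> vec.independent S})"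

lemma is_matroid_linear_matroid:
  fixes X :: "('a::field ^ 'm) set"
  assumes "finite X"
  shows "is_matroid (linear_matroid X)"
proof -
  have "\<exists>x \<in> T - S. insert x S \<subseteq> X \<and> vec.independent (insert x S)"
    if S: "S \<subseteq> X" "vec.independent S" and T: "T \<subseteq> X" "vec.independent T"
      and c: "card S < card T" for S T
  proof -
    have "\<not> T \<subseteq> vec.span S"
      using vec.independent_span_bound[of S T] S T c assms finite_subset[of S X] by auto
    then obtain x where "x \<in> T" "x \<notin> vec.span S" by blast
    then show ?thesis
      using S T vec.independent_insertI[of x S] vec.span_base[of x S] by blast
  qed
  then show ?thesis
    using assms
    by (auto simp: is_matroid_def linear_matroid_def vec.independent_empty
        dest: vec.independent_mono)
qed

lemma matroid_rank_linear_matroid: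
  fixes X :: "('a::field ^ 'm) set"
  assumes "finite X" and "vec.span X = UNIV"
  shows "matroid_rank (linear_matroid X) = CARD('m)"
proof -
  obtain B where B: "B \<subseteq> X" "vec.independent B" "X \<subseteq> vec.span B"
    using vec.maximal_independent_subset[of X] by blast
  have "vec.span B = UNIV"
    using B(3) assms(2) vec.span_minimal[OF B(3) vec.subspace_span] by auto
  then have "card B = CARD('m)"
    using vec.basis_card_eq_dim[of B UNIV] B(2) vec_dim_card[where 'a='a and 'n='m] by auto
  moreover have "card S \<le> CARD('m)" if "vec.independent S" for S :: "('a ^ 'm) set"
    using vec.independent_card_le_dim[of S UNIV] that
      vec_dim_card[where 'a='a and 'n='m] by auto
  ultimately show ?thesis
    unfolding matroid_rank_def linear_matroid_def snd_conv
    using B assms(1) by (intro Max_eqI) (auto intro!: image_eqI[of _ _ B])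
qed

end

(* The inequality is the log-concavity along y of the Lorentzian polynomial
     F(x, y) = sum over independent J of w(|J|) x^J y^(k+1-|J|) / (k+1-|J|)!,
   where w(j) = 1 for j <= k and w(k+1) = p / (p - 1), with p = q^(m-k+1) - 1.
   Hyperbolicity of the Hessian of F and of all its derivatives is proved by induction on the
   degree from the derivatives of degree 2. The one indexed by an independent set S is the square of
   a linear form minus a form which is positive semidefinite as soon as w is constant on
   |S|, |S| + 1, |S| + 2, or M/S has at most p parallel classes; over F_q the latter holds when
   |S| = k - 1, because distinct classes give disjoint cosets of span S. The comparison of F at
   x = (1, ..., 1), y -> 0 with the numbers I(j) yields the factor 1 + 1/k. *)
theory Submission
  imports Defs "HOL-Library.Multiset"
begin

section \<open>Bilinear forms, hyperbolicity and the reverse Cauchy-Schwarz inequality\<close>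

definition bilin :: "'i set \<Rightarrow> ('i \<Rightarrow> 'i \<Rightarrow> real) \<Rightarrow> ('i \<Rightarrow> real) \<Rightarrow> ('i \<Rightarrow> real) \<Rightarrow> real" where
  "bilin N B x y = (\<Sum>i\<in>N. \<Sum>j\<in>N. B i j * x i * y j)"

lemma bilin_add_left: "bilin N B (\<lambda>i. x i + y i) z = bilin N B x z + bilin N B y z"
  by (simp add: bilin_def algebra_simps sum.distrib)

lemma bilin_scale_left: "bilin N B (\<lambda>i. c * x i) z = c * bilin N B x z"
  by (simp add: bilin_def algebra_simps sum_distrib_left)

lemma bilin_add_right: "bilin N B z (\<lambda>i. x i + y i) = bilin N B z x + bilin N B z y"
  by (simp add: bilin_def algebra_simps sum.distrib)

lemma bilin_scale_right: "bilin N B z (\<lambda>i. c * x i) = c * bilin N B z x"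
  by (simp add: bilin_def algebra_simps sum_distrib_left)

lemma bilin_commute:
  assumes "\<And>i j. i \<in> N \<Longrightarrow> j \<in> N \<Longrightarrow> B i j = B j i"
  shows "bilin N B x y = bilin N B y x"
proof -
  have "bilin N B x y = (\<Sum>j\<in>N. \<Sum>i\<in>N. B i j * x i * y j)"
    unfolding bilin_def by (rule sum.swap)
  also have "\<dots> = bilin N B y x"
    unfolding bilin_def using assms by (intro sum.cong) auto
  finally show ?thesis .
qed

lemma bilin_square_add:
  assumes "\<And>i j. i \<in> N \<Longrightarrow> j \<in> N \<Longrightarrow> B i j = B j i"
  shows "bilin N B (\<lambda>i. x i + t * y i) (\<lambda>i. x i + t * y i)
    = bilin N B x x + 2 * t * bilin N B x y + t\<^sup>2 * bilin N B y y"
  by (simp add: bilin_add_left bilin_add_right bilin_scale_left bilin_scale_right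
      bilin_commute[OF assms, where x = y and y = x] power2_eq_square algebra_simps)

lemma bilin_eq_sum_rows: "bilin N B x y = (\<Sum>i\<in>N. x i * (\<Sum>j\<in>N. B i j * y j))"
  by (simp add: bilin_def sum_distrib_left mult_ac)

lemma bilin_sum: "bilin N (\<lambda>i j. \<Sum>l\<in>L. T l i j) x y = (\<Sum>l\<in>L. bilin N (T l) x y)"
proof -
  have "(\<Sum>l\<in>L. bilin N (T l) x y) = (\<Sum>i\<in>N. \<Sum>l\<in>L. \<Sum>j\<in>N. T l i j * x i * y j)"
    unfolding bilin_def by (rule sum.swap)
  also have "\<dots> = (\<Sum>i\<in>N. \<Sum>j\<in>N. \<Sum>l\<in>L. T l i j * x i * y j)"
    by (intro sum.cong sum.swap) simp
  finally show ?thesis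
    by (simp add: bilin_def sum_distrib_right)
qed

text \<open>The comparison is with the all-one vector only; other positive directions are reached by
  rescaling the entries of \<open>B\<close>, which is how \<epsilon> enters
  \<open>indep_tensor\<close>.\<close>

definition hyperbolic :: "'i set \<Rightarrow> ('i \<Rightarrow> 'i \<Rightarrow> real) \<Rightarrow> bool" where
  "hyperbolic N B \<longleftrightarrow>
    (\<forall>z. bilin N B z z * bilin N B (\<lambda>_. 1) (\<lambda>_. 1) \<le> (bilin N B z (\<lambda>_. 1))\<^sup>2)"

text \<open>As a polynomial in \<open>t\<close>, the form on the line through \<open>z\<close> in
  direction \<open>v\<close> has nonnegative leading coefficient and takes a nonpositive value, so
  its discriminant is nonnegative.\<close>

lemma reverse_Cauchy_Schwarz:
  assumes sym: "\<And>i j. i \<in> N \<Longrightarrow> j \<in> N \<Longrightarrow> B i j = B j i"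
    and neg: "bilin N B (\<lambda>i. z i + t * v i) (\<lambda>i. z i + t * v i) \<le> 0"
    and pos: "0 \<le> bilin N B v v"
  shows "bilin N B z z * bilin N B v v \<le> (bilin N B z v)\<^sup>2"
proof -
  let ?z = "bilin N B z z" and ?b = "bilin N B z v" and ?v = "bilin N B v v"
  have "(?z + 2 * t * ?b + t\<^sup>2 * ?v) * ?v \<le> 0"
    using neg pos by (simp add: bilin_square_add[OF sym] mult_nonpos_nonneg)
  then have "?z * ?v + (?b + t * ?v)\<^sup>2 \<le> ?b\<^sup>2"
    by (simp add: power2_eq_square algebra_simps)
  then show ?thesis
    using zero_le_power2[of "?b + t * ?v"] by linarith
qed

section \<open>Spectral argument: from slices to their sum\<close>

text \<open>A Rayleigh quotient is maximised on this set later. Each summand of the weighted norm is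
  at most 1, which bounds the coordinates in \<open>U\<close>; \<open>PiE\<close> pins the others,
  which the two equations leave free.\<close>

lemma compact_weighted_sphere:
  fixes c :: "'i \<Rightarrow> real"
  assumes fin: "finite U" and c: "\<And>i. i \<in> U \<Longrightarrow> 0 < c i"
  shows "compact {z \<in> PiE U (\<lambda>_. UNIV). (\<Sum>i\<in>U. c i * z i) = 0 \<and> (\<Sum>i\<in>U. c i * (z i)\<^sup>2) = 1}"
    (is "compact ?K")
proof -
  define P where "P = PiE U (\<lambda>i. {- (1 / sqrt (c i)) .. 1 / sqrt (c i)})"
  have P: "compact P"
  proof -
    \<comment> \<open>Outside \<open>U\<close> the factor is the singleton
      \<open>{undefined}\<close>, so the extensional box becomes a full product of compact sets and
      Tychonoff's theorem applies.\<close>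
    define S where "S i = (if i \<in> U then {- (1 / sqrt (c i)) .. 1 / sqrt (c i)} else {undefined})" for i
    have "P = PiE UNIV S"
      unfolding P_def S_def by (auto simp: PiE_iff extensional_def split: if_splits)
    moreover have "compactin (product_topology (\<lambda>i. euclideanreal) UNIV) (PiE UNIV S)"
      unfolding compactin_PiE S_def by auto
    ultimately show ?thesis
      by (simp add: euclidean_product_topology)
  qed
  have cont: "continuous_on UNIV (\<lambda>z :: 'i \<Rightarrow> real. z i)" for i
    by simp
  have "?K = P \<inter> ({z. (\<Sum>i\<in>U. c i * z i) = 0} \<inter> {z. (\<Sum>i\<in>U. c i * (z i)\<^sup>2) = 1})"
  proof -
    have "\<bar>z i\<bar> \<le> 1 / sqrt (c i)" if "(\<Sum>i\<in>U. c i * (z i)\<^sup>2) = 1" "i \<in> U" for z i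
    proof -
      have "c i * (z i)\<^sup>2 \<le> 1"
        unfolding that(1)[symmetric] using that(2) fin c
        by (intro member_le_sum) (auto simp: less_imp_le)
      then have "sqrt (c i * (z i)\<^sup>2) \<le> 1"
        by simp
      then show ?thesis
        using c[OF that(2)] by (simp add: real_sqrt_mult field_simps)
    qed
    then show ?thesis
      unfolding P_def by (auto simp: PiE_iff abs_le_iff minus_le_iff extensional_def)
  qed
  moreover have "closed ({z. (\<Sum>i\<in>U. c i * z i) = 0} \<inter> {z. (\<Sum>i\<in>U. c i * (z i)\<^sup>2) = 1})"
    by (intro closed_Int closed_Collect_eq continuous_intros cont)
  ultimately show ?thesis
    using P by (simp add: compact_Int_closed)
qed

text \<open>First-order condition: the quadratic has its minimum 0 at \<open>t = 0\<close>, so its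
  derivative \<open>2 * b\<close> there vanishes.\<close>

lemma quadratic_nonneg_imp_linear_zero:
  fixes b c :: real
  assumes "\<And>t. 0 \<le> 2 * t * b + t\<^sup>2 * c"
  shows "b = 0"
proof (rule ccontr)
  assume b: "b \<noteq> 0"
  define s where "s = 1 + \<bar>c\<bar>"
  have s: "s > 0" "c \<le> s" by (auto simp: s_def)
  have "0 \<le> 2 * (- b / s) * b + (- b / s)\<^sup>2 * c"
    by (rule assms)
  also have "\<dots> \<le> 2 * (- b / s) * b + (- b / s)\<^sup>2 * s"
    using s by (intro add_left_mono mult_left_mono) auto
  also have "\<dots> = - (b\<^sup>2 / s)"
    using s by (simp add: field_simps power2_eq_square)
  also have "\<dots> < 0"
    using s b by simp
  finally show False by simp
qed

text \<open>Expanding the squares gives the Dirichlet form of the graph with edge weights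
  \<open>B\<close>; for nonnegative weights it vanishes only on vectors that are constant along
  edges.\<close>

lemma bilin_laplacian:
  assumes sym: "\<And>i j. i \<in> N \<Longrightarrow> j \<in> N \<Longrightarrow> B i j = B j i"
  shows "(\<Sum>i\<in>N. (\<Sum>j\<in>N. B i j) * (z i)\<^sup>2) - bilin N B z z
    = (\<Sum>i\<in>N. \<Sum>j\<in>N. B i j * (z i - z j)\<^sup>2) / 2"
proof -
  have 1: "(\<Sum>i\<in>N. \<Sum>j\<in>N. B i j * (z j)\<^sup>2) = (\<Sum>i\<in>N. \<Sum>j\<in>N. B i j * (z i)\<^sup>2)"
    by (subst sum.swap) (use sym in \<open>auto intro!: sum.cong\<close>)
  have "(\<Sum>i\<in>N. \<Sum>j\<in>N. B i j * (z i - z j)\<^sup>2)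
    = (\<Sum>i\<in>N. \<Sum>j\<in>N. B i j * (z i)\<^sup>2) + (\<Sum>i\<in>N. \<Sum>j\<in>N. B i j * (z j)\<^sup>2) - 2 * bilin N B z z"
    by (simp add: bilin_def power2_eq_square algebra_simps sum.distrib sum_subtractf sum_distrib_left)
  then show ?thesis
    unfolding 1 by (simp add: sum_distrib_left sum_distrib_right mult_ac)
qed

text \<open>Put \<open>A = diag(c)\<inverse> B\<close>, which is self-adjoint for the inner product with weights \<open>c\<close> and fixes
  the constant vectors. The hypothesis \<open>main\<close> says that \<open>A \<le> A\<^sup>2\<close>, so no eigenvalue of \<open>A\<close> lies in
  \<open>(0, 1)\<close>; by Perron--Frobenius the eigenvalue \<open>1\<close> is the largest one and is simple.\<close>

lemma bilin_nonpos_on_complement: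
  assumes fin: "finite U"
    and sym: "\<And>i j. i \<in> U \<Longrightarrow> j \<in> U \<Longrightarrow> B i j = B j i"
    and nonneg: "\<And>i j. i \<in> U \<Longrightarrow> j \<in> U \<Longrightarrow> 0 \<le> B i j"
    and y: "y \<in> U" "\<And>i. i \<in> U \<Longrightarrow> 0 < B i y"
    and c_def: "c = (\<lambda>i. \<Sum>j\<in>U. B i j)"
    and main: "\<And>z. bilin U B z z \<le> (\<Sum>i\<in>U. (\<Sum>j\<in>U. B i j * z j)\<^sup>2 / c i)"
    and z: "(\<Sum>i\<in>U. c i * z i) = 0"
  shows "bilin U B z z \<le> 0"
proof (rule ccontr)
  have c: "0 < c i" if "i \<in> U" for i
  proof -
    have "B i y \<le> c i"
      unfolding c_def using that y fin nonneg by (intro member_le_sum) auto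
    with y(2)[OF that] show ?thesis by linarith
  qed
  have c1: "bilin U B x (\<lambda>_. 1) = (\<Sum>i\<in>U. c i * x i)" for x
    by (simp add: bilin_eq_sum_rows c_def mult.commute)
  define ip where "ip u v = (\<Sum>i\<in>U. c i * u i * v i)" for u v :: "'a \<Rightarrow> real"
  define K where "K = {z \<in> PiE U (\<lambda>_. UNIV). (\<Sum>i\<in>U. c i * z i) = 0 \<and> (\<Sum>i\<in>U. c i * (z i)\<^sup>2) = 1}"
  have comp: "compact K"
    unfolding K_def by (rule compact_weighted_sphere[OF fin c])
  have normalize: "\<exists>s>0. s\<^sup>2 * ip w w = 1 \<and> restrict (\<lambda>i. s * w i) U \<in> K
      \<and> bilin U B (restrict (\<lambda>i. s * w i) U) (restrict (\<lambda>i. s * w i) U) = s\<^sup>2 * bilin U B w w"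
    if "(\<Sum>i\<in>U. c i * w i) = 0" "0 < ip w w" for w
  proof -
    define s where "s = 1 / sqrt (ip w w)"
    have s: "s > 0" "s\<^sup>2 * ip w w = 1"
      using that by (auto simp: s_def power_divide)
    have "bilin U B (restrict (\<lambda>i. s * w i) U) (restrict (\<lambda>i. s * w i) U)
        = bilin U B (\<lambda>i. s * w i) (\<lambda>i. s * w i)"
      unfolding bilin_def by (intro sum.cong) auto
    also have "\<dots> = s\<^sup>2 * bilin U B w w"
      by (simp add: bilin_scale_left bilin_scale_right power2_eq_square)
    finally have q: "bilin U B (restrict (\<lambda>i. s * w i) U) (restrict (\<lambda>i. s * w i) U)
      = s\<^sup>2 * bilin U B w w" .
    have "(\<Sum>i\<in>U. c i * (s * w i)) = s * (\<Sum>i\<in>U. c i * w i)"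
      by (simp add: sum_distrib_left mult_ac)
    moreover have "(\<Sum>i\<in>U. c i * (s * w i)\<^sup>2) = s\<^sup>2 * ip w w"
      by (simp add: ip_def sum_distrib_left power2_eq_square mult_ac)
    ultimately have "restrict (\<lambda>i. s * w i) U \<in> K"
      using that s by (simp add: K_def)
    with s q show ?thesis by blast
  qed
  have ip0: "ip w w = 0 \<longleftrightarrow> (\<forall>i\<in>U. w i = 0)" and ip_nonneg: "0 \<le> ip w w" for w
  proof -
    have *: "0 \<le> c i * w i * w i" if "i \<in> U" for i
      using c[OF that] by (simp add: mult.assoc)
    show "0 \<le> ip w w"
      unfolding ip_def using * by (intro sum_nonneg) auto
    show "ip w w = 0 \<longleftrightarrow> (\<forall>i\<in>U. w i = 0)"
      unfolding ip_def using * c fin by (subst sum_nonneg_eq_0_iff) fastforce+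
  qed
  assume "\<not> bilin U B z z \<le> 0"
  then have zpos: "bilin U B z z > 0" by simp
  have "ip z z \<noteq> 0"
  proof
    assume "ip z z = 0"
    then have "\<forall>i\<in>U. z i = 0" by (simp add: ip0)
    then have "bilin U B z z = 0" by (simp add: bilin_def)
    with zpos show False by simp
  qed
  then have "0 < ip z z" using ip_nonneg[of z] by linarith
  from normalize[OF z this] obtain s where s: "s > 0" "restrict (\<lambda>i. s * z i) U \<in> K"
    "bilin U B (restrict (\<lambda>i. s * z i) U) (restrict (\<lambda>i. s * z i) U) = s\<^sup>2 * bilin U B z z"
    by blast
  have cont: "continuous_on K (\<lambda>z. bilin U B z z)"
    unfolding bilin_def
    by (intro continuous_intros continuous_on_subset[OF continuous_on_product_coordinates]) auto
  obtain z0 where z0: "z0 \<in> K" "\<And>w. w \<in> K \<Longrightarrow> bilin U B w w \<le> bilin U B z0 z0"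
    using continuous_attains_sup[OF comp _ cont] s(2) by blast
  define ev where "ev = bilin U B z0 z0"
  have "0 < ev"
    using z0(2)[OF s(2)] s zpos by (auto simp: ev_def intro: less_le_trans[rotated])
  have z0W: "(\<Sum>i\<in>U. c i * z0 i) = 0" and z0n: "ip z0 z0 = 1"
    using z0(1) by (auto simp: K_def ip_def power2_eq_square mult_ac)
  have max: "bilin U B w w \<le> ev * ip w w" if w: "(\<Sum>i\<in>U. c i * w i) = 0" for w
  proof (cases "ip w w = 0")
    case True
    then have "bilin U B w w = 0" by (simp add: bilin_def ip0)
    with True show ?thesis by simp
  next
    case False
    then have "0 < ip w w" using ip_nonneg[of w] by linarith
    from normalize[OF w this] obtain s where s: "s > 0" "s\<^sup>2 * ip w w = 1"
       "s\<^sup>2 * bilin U B w w \<le> ev"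
      using z0(2) unfolding ev_def by metis
    then have "s\<^sup>2 * bilin U B w w \<le> s\<^sup>2 * (ev * ip w w)"
      by (simp add: algebra_simps)
    then show ?thesis using s(1) by simp
  qed
  have orth: "bilin U B z0 w = ev * ip z0 w" if w: "(\<Sum>i\<in>U. c i * w i) = 0" for w
  proof -
    \<comment> \<open>Maximality of \<open>z0\<close> is compared with \<open>z0 + t * w\<close> for
      every \<open>t\<close>; the constant terms cancel because \<open>ip z0 z0 = 1\<close>.\<close>
    have "ev * ip z0 w - bilin U B z0 w = 0"
    proof (rule quadratic_nonneg_imp_linear_zero[where c = "ev * ip w w - bilin U B w w"])
      fix t
      have "(\<Sum>i\<in>U. c i * (z0 i + t * w i)) = (\<Sum>i\<in>U. c i * z0 i) + t * (\<Sum>i\<in>U. c i * w i)"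
        by (simp add: algebra_simps sum.distrib sum_distrib_left)
      then have "bilin U B (\<lambda>i. z0 i + t * w i) (\<lambda>i. z0 i + t * w i)
          \<le> ev * ip (\<lambda>i. z0 i + t * w i) (\<lambda>i. z0 i + t * w i)"
        using z0W w by (intro max) simp
      moreover have "ip (\<lambda>i. z0 i + t * w i) (\<lambda>i. z0 i + t * w i)
          = ip z0 z0 + 2 * t * ip z0 w + t\<^sup>2 * ip w w"
        by (simp add: ip_def algebra_simps power2_eq_square sum.distrib sum_distrib_left)
      ultimately have "bilin U B z0 z0 + 2 * t * bilin U B z0 w + t\<^sup>2 * bilin U B w w
          \<le> ev * (ip z0 z0 + 2 * t * ip z0 w + t\<^sup>2 * ip w w)"
        by (simp add: bilin_square_add[OF sym])
      then show "0 \<le> 2 * t * (ev * ip z0 w - bilin U B z0 w) + t\<^sup>2 * (ev * ip w w - bilin U B w w)"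
        using z0n by (simp add: ev_def algebra_simps)
    qed
    then show ?thesis by simp
  qed
  have eigen: "(\<Sum>j\<in>U. B i j * z0 j) = ev * c i * z0 i" if i: "i \<in> U" for i
  proof -
    define C where "C = (\<Sum>j\<in>U. c j)"
    have "C > 0" unfolding C_def using c fin y(1) by (intro sum_pos) auto
    define r where "r = c i / C"
    \<comment> \<open>The indicator of \<open>i\<close>, projected onto the complement of the
      constants so that \<open>orth\<close> applies. The subtracted constant pairs to zero with
      \<open>z0\<close> in both forms.\<close>
    define w where "w = (\<lambda>j. (if j = i then 1 else 0) + (- r) * 1 :: real)"
    have "(\<Sum>j\<in>U. c j * w j) = c i - C * r"
      using fin i by (simp add: w_def algebra_simps sum_subtractf sum_distrib_left[symmetric] C_def
          if_distrib[of "\<lambda>x. _ * x"] sum.delta cong: if_cong)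
    then have "(\<Sum>j\<in>U. c j * w j) = 0"
      using \<open>C > 0\<close> by (simp add: r_def)
    from orth[OF this] have "bilin U B z0 w = ev * ip z0 w" .
    moreover have "bilin U B z0 w = bilin U B z0 (\<lambda>j. if j = i then 1 else 0)"
      unfolding w_def by (simp only: bilin_add_right bilin_scale_right c1 z0W mult_zero_right add_0_right)
    moreover have "bilin U B z0 (\<lambda>j. if j = i then 1 else 0) = (\<Sum>j\<in>U. B i j * z0 j)"
    proof -
      have "bilin U B z0 (\<lambda>j. if j = i then 1 else 0) = (\<Sum>j\<in>U. B j i * z0 j)"
        using fin i unfolding bilin_def
        by (simp add: if_distrib[of "\<lambda>x. _ * x"] sum.delta cong: if_cong)
      also have "\<dots> = (\<Sum>j\<in>U. B i j * z0 j)"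
        using sym i by (intro sum.cong) auto
      finally show ?thesis .
    qed
    moreover have "ip z0 w = c i * z0 i"
    proof -
      have "ip z0 w = c i * z0 i - r * (\<Sum>j\<in>U. c j * z0 j)"
        using fin i by (simp add: ip_def w_def algebra_simps sum_subtractf sum_distrib_left
            if_distrib[of "\<lambda>x. _ * x"] sum.delta cong: if_cong)
      then show ?thesis by (simp add: z0W)
    qed
    ultimately show ?thesis by simp
  qed
  \<comment> \<open>At the eigenvector \<open>z0\<close> the hypothesis \<open>main\<close> reads
    \<open>ev \<le> ev^2\<close>, so \<open>ev \<ge> 1\<close>; then the Dirichlet form of
    \<open>z0\<close> is nonpositive, hence zero.\<close>
  have "ev \<le> (\<Sum>i\<in>U. (ev * c i * z0 i)\<^sup>2 / c i)"
    using main[of z0] by (simp add: ev_def[symmetric] eigen)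
  also have "\<dots> = (\<Sum>i\<in>U. ev\<^sup>2 * (c i * z0 i * z0 i))"
    by (intro sum.cong) (use c in \<open>auto simp: power2_eq_square field_simps dest: c\<close>)
  also have "\<dots> = ev\<^sup>2"
    using z0n by (simp add: ip_def sum_distrib_left[symmetric])
  finally have "1 \<le> ev"
    using \<open>0 < ev\<close> by (simp add: power2_eq_square)
  then have "(\<Sum>i\<in>U. \<Sum>j\<in>U. B i j * (z0 i - z0 j)\<^sup>2) \<le> 0"
    using bilin_laplacian[of U B z0, OF sym] z0n
    by (simp add: ev_def ip_def c_def power2_eq_square mult.assoc)
  then have "(\<Sum>i\<in>U. \<Sum>j\<in>U. B i j * (z0 i - z0 j)\<^sup>2) = 0"
    using nonneg by (intro antisym sum_nonneg) auto
  then have "\<forall>i\<in>U. \<forall>j\<in>U. B i j * (z0 i - z0 j)\<^sup>2 = 0"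
    using nonneg fin by (simp add: sum_nonneg_eq_0_iff sum_nonneg)
  \<comment> \<open>Every index is joined to \<open>y\<close> by a positive entry, so a vanishing
    Dirichlet form makes \<open>z0\<close> constant; its weighted sum being 0 then forces it to
    vanish.\<close>
  then have const: "z0 i = z0 y" if "i \<in> U" for i
    using y that by fastforce
  have "(\<Sum>i\<in>U. c i) * z0 y = 0"
    using z0W const by (simp add: sum_distrib_right)
  moreover have "(\<Sum>i\<in>U. c i) > 0"
    using c fin y(1) by (intro sum_pos) auto
  ultimately have "ip z0 z0 = 0"
    using const by (simp add: ip0)
  with z0n show False by simp
qed

text \<open>Summing the hyperbolicity of the slices \<open>T l\<close> gives exactly the hypothesis \<open>A \<le> A\<^sup>2\<close> of the
  previous lemma for the matrix \<open>B\<close>.\<close>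

lemma hyperbolic_local_to_global:
  fixes T :: "'i \<Rightarrow> 'i \<Rightarrow> 'i \<Rightarrow> real"
  assumes fin: "finite N"
    and sym: "\<And>l i j. T l i j = T l j i" "\<And>l i j. T l i j = T i l j"
    and nonneg: "\<And>l i j. l \<in> N \<Longrightarrow> i \<in> N \<Longrightarrow> j \<in> N \<Longrightarrow> 0 \<le> T l i j"
    and slice: "\<And>l. l \<in> N \<Longrightarrow> hyperbolic N (T l)"
    and B_def: "B = (\<lambda>i j. \<Sum>l\<in>N. T l i j)"
    and y: "y \<in> N" "\<And>i. i \<in> N \<Longrightarrow> 0 < (\<Sum>j\<in>N. B i j) \<Longrightarrow> 0 < B i y"
  shows "hyperbolic N B"
  unfolding hyperbolic_def
proof
  fix z
  define c where "c = (\<lambda>i. \<Sum>j\<in>N. B i j)"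
  \<comment> \<open>Indices with zero row sum have zero rows and zero slices; discarding them leaves
    positive weights \<open>c\<close>, by which one can divide.\<close>
  define U where "U = {i \<in> N. 0 < c i}"
  have U: "finite U" "U \<subseteq> N" using fin by (auto simp: U_def)
  have Bsym: "B i j = B j i" for i j
    unfolding B_def using sym by simp
  have Bnn: "0 \<le> B i j" if "i \<in> N" "j \<in> N" for i j
    unfolding B_def using that nonneg by (intro sum_nonneg) auto
  \<comment> \<open>By full symmetry, contracting the slice \<open>T l\<close> with the all-one
    vector gives row \<open>l\<close> of \<open>B\<close>, so hyperbolicity of the slice bounds
    \<open>T l\<close> by the square of that row.\<close>
  have rows: "(\<Sum>j\<in>N. T l i j) = B l i" for l i
  proof -
    have "T l i j = T j l i" for j
      by (metis sym)
    then show ?thesis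
      by (simp add: B_def)
  qed
  have c0: "c i = 0" if "i \<in> N" "i \<notin> U" for i
  proof -
    have "0 \<le> c i" unfolding c_def using that Bnn by (intro sum_nonneg) auto
    with that show ?thesis by (auto simp: U_def)
  qed
  have B0: "B i j = 0" if "i \<in> N" "j \<in> N" "i \<notin> U" for i j
    using c0[OF that(1,3)] that Bnn fin unfolding c_def by (subst (asm) sum_nonneg_eq_0_iff) auto
  have T0: "T l i j = 0" if "l \<in> N" "i \<in> N" "j \<in> N" "l \<notin> U" for l i j
    using B0[OF that(1,2,4)] that nonneg fin unfolding rows[symmetric]
    by (subst (asm) sum_nonneg_eq_0_iff) auto
  have restr: "(\<Sum>j\<in>N. B i j * x j) = (\<Sum>j\<in>U. B i j * x j)" if "i \<in> N" for i x
    using that U fin B0[of _ i] Bsym by (intro sum.mono_neutral_right) auto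
  have c_U: "c i = (\<Sum>j\<in>U. B i j)" if "i \<in> N" for i
    using restr[OF that, of "\<lambda>_. 1"] by (simp add: c_def)
  have bilin_U: "bilin N B x x' = bilin U B x x'" for x x'
  proof -
    have "bilin N B x x' = (\<Sum>i\<in>N. x i * (\<Sum>j\<in>U. B i j * x' j))"
      by (simp add: bilin_eq_sum_rows restr)
    also have "\<dots> = (\<Sum>i\<in>U. x i * (\<Sum>j\<in>U. B i j * x' j))"
      using U fin B0 by (intro sum.mono_neutral_right) (auto intro!: sum.neutral)
    finally show ?thesis by (simp add: bilin_eq_sum_rows)
  qed
  have slice_bound: "bilin N (T l) x x \<le> (\<Sum>j\<in>N. B l j * x j)\<^sup>2 / c l" if l: "l \<in> U" for l x
  proof -
    have lN: "l \<in> N" and cl: "0 < c l" using l by (auto simp: U_def)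
    have "bilin N (T l) (\<lambda>_. 1) (\<lambda>_. 1) = c l"
      by (simp add: bilin_eq_sum_rows rows c_def)
    moreover have "bilin N (T l) x (\<lambda>_. 1) = (\<Sum>j\<in>N. B l j * x j)"
      by (simp add: bilin_eq_sum_rows rows mult.commute)
    ultimately have "bilin N (T l) x x * c l \<le> (\<Sum>j\<in>N. B l j * x j)\<^sup>2"
      using slice[OF lN] unfolding hyperbolic_def by metis
    then show ?thesis using cl by (simp add: field_simps)
  qed
  have main: "bilin U B x x \<le> (\<Sum>i\<in>U. (\<Sum>j\<in>U. B i j * x j)\<^sup>2 / (\<Sum>j\<in>U. B i j))" for x
  proof -
    have "bilin U B x x = bilin N B x x"
      by (simp add: bilin_U)
    also have "\<dots> = (\<Sum>l\<in>N. bilin N (T l) x x)"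
      unfolding B_def by (rule bilin_sum)
    also have "\<dots> = (\<Sum>l\<in>U. bilin N (T l) x x)"
      using U fin T0 by (intro sum.mono_neutral_right) (auto simp: bilin_def intro!: sum.neutral)
    also have "\<dots> \<le> (\<Sum>l\<in>U. (\<Sum>j\<in>N. B l j * x j)\<^sup>2 / c l)"
      by (intro sum_mono slice_bound)
    also have "\<dots> = (\<Sum>i\<in>U. (\<Sum>j\<in>U. B i j * x j)\<^sup>2 / (\<Sum>j\<in>U. B i j))"
      using U by (intro sum.cong refl) (auto simp: restr c_U subset_iff)
    finally show ?thesis .
  qed
  have c1: "bilin N B x (\<lambda>_. 1) = (\<Sum>i\<in>U. c i * x i)" for x
  proof -
    have "bilin N B x (\<lambda>_. 1) = (\<Sum>i\<in>N. c i * x i)"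
      by (simp add: bilin_eq_sum_rows c_def mult.commute)
    also have "\<dots> = (\<Sum>i\<in>U. c i * x i)"
      using U fin c0 by (intro sum.mono_neutral_right) auto
    finally show ?thesis .
  qed
  show "bilin N B z z * bilin N B (\<lambda>_. 1) (\<lambda>_. 1) \<le> (bilin N B z (\<lambda>_. 1))\<^sup>2"
  proof (cases "U = {}")
    case True
    then show ?thesis by (simp add: c1)
  next
    case False
    define C where "C = (\<Sum>i\<in>U. c i)"
    have C: "C > 0" unfolding C_def using False U by (intro sum_pos) (auto simp: U_def)
    obtain i where i: "i \<in> U" using False by blast
    have By: "0 < B i y" if "i \<in> U" for i
      using that y(2) by (auto simp: U_def c_def)
    have yU: "y \<in> U"
      using B0[of y i] By[OF i] Bsym[of i y] y(1) i U by (metis less_irrefl subsetD)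
    define t where "t = - (\<Sum>i\<in>U. c i * z i) / C"
    have "(\<Sum>i\<in>U. c i * (z i + t * 1)) = (\<Sum>i\<in>U. c i * z i) + t * C"
      by (simp add: C_def algebra_simps sum.distrib sum_distrib_left)
    then have "(\<Sum>i\<in>U. c i * (z i + t * 1)) = 0"
      using C by (simp add: t_def)
    then have "(\<Sum>i\<in>U. (\<Sum>j\<in>U. B i j) * (z i + t * 1)) = 0"
      using U by (simp add: c_U[symmetric] subset_iff)
    then have "bilin U B (\<lambda>i. z i + t * 1) (\<lambda>i. z i + t * 1) \<le> 0"
      using U Bnn by (intro bilin_nonpos_on_complement[OF U(1) Bsym _ yU By refl main]) auto
    then show ?thesis
      using C by (intro reverse_Cauchy_Schwarz[OF Bsym, where t = t]) (simp_all add: bilin_U c1[unfolded bilin_U] C_def)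
  qed
qed

section \<open>Contractions of symmetric tensors indexed by multisets\<close>

text \<open>If \<open>f\<close> is read as a symmetric tensor indexed by multisets, \<open>polar f N M e\<close> is its contraction
  with the index \<open>M\<close> and \<open>e\<close> copies of the all-one vector, i.e. up to a factor the value at that
  vector of the \<open>M\<close>-th partial derivative of the corresponding homogeneous polynomial.\<close>

primrec polar :: "('i multiset \<Rightarrow> real) \<Rightarrow> 'i set \<Rightarrow> 'i multiset \<Rightarrow> nat \<Rightarrow> real" where
  "polar f N M 0 = f M"
| "polar f N M (Suc e) = (\<Sum>a\<in>N. polar f N (add_mset a M) e)"

lemma polar_eq_0:
  assumes "\<And>a M. f M = 0 \<Longrightarrow> f (add_mset a M) = 0" and "f M = 0"
  shows "polar f N M e = 0"
  using assms(2) by (induction e arbitrary: M) (auto intro!: sum.neutral assms(1))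

text \<open>By \<open>f_add\<close> the support of \<open>f\<close> is closed under submultisets;
  \<open>f_y\<close> joins every index of a nonzero row to \<open>y\<close>. In the application
  \<open>y\<close> is the homogenising variable \<open>None\<close>.\<close>

context
  fixes f :: "'i multiset \<Rightarrow> real" and N :: "'i set" and y :: 'i
  assumes fin: "finite N" and yN: "y \<in> N"
    and f_nonneg: "\<And>M. 0 \<le> f M"
    and f_add: "\<And>a M. f M = 0 \<Longrightarrow> f (add_mset a M) = 0"
    and f_y: "\<And>M. 0 < f M \<Longrightarrow> 0 < f (add_mset y M)"
begin

lemma polar_nonneg: "0 \<le> polar f N M e"
  by (induction e arbitrary: M) (auto intro: sum_nonneg f_nonneg)

lemma polar_pos: "0 < f M \<Longrightarrow> 0 < polar f N M e"
proof (induction e arbitrary: M)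
  case (Suc e)
  then have "0 < polar f N (add_mset y M) e"
    by (simp add: f_y)
  also have "\<dots> \<le> polar f N M (Suc e)"
    using fin yN by (auto intro!: member_le_sum[where f = "\<lambda>a. polar f N (add_mset a M) e"]
        simp: polar_nonneg)
  finally show ?case .
qed simp

text \<open>Induction on \<open>e\<close>: the form for \<open>Suc e\<close> is the sum over
  \<open>l\<close> of the forms for \<open>e\<close> with \<open>l\<close> added to
  \<open>M\<close>, which are slices of one symmetric tensor. So only the forms of degree 2 have to
  be checked.\<close>

lemma hyperbolic_polar:
  assumes base: "\<And>M. set_mset M \<subseteq> N \<Longrightarrow> size M = d
      \<Longrightarrow> hyperbolic N (\<lambda>a b. f (add_mset a (add_mset b M)))"
    and "set_mset M \<subseteq> N" "size M + e = d"
  shows "hyperbolic N (\<lambda>a b. polar f N (add_mset a (add_mset b M)) e)"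
  using assms(2,3)
proof (induction e arbitrary: M)
  case 0
  then show ?case using base by simp
next
  case (Suc e)
  let ?T = "\<lambda>l a b. polar f N (add_mset a (add_mset b (add_mset l M))) e"
  show ?case
  proof (rule hyperbolic_local_to_global[where T = ?T and y = y, OF fin])
    show "hyperbolic N (?T l)" if "l \<in> N" for l
      using Suc that by (intro Suc.IH) auto
    show "(\<lambda>a b. polar f N (add_mset a (add_mset b M)) (Suc e)) = (\<lambda>i j. \<Sum>l\<in>N. ?T l i j)"
      by (simp add: add_mset_commute)
    fix i assume "0 < (\<Sum>j\<in>N. polar f N (add_mset i (add_mset j M)) (Suc e))"
    then have "0 < polar f N (add_mset i M) (Suc (Suc e))"
      by (simp add: add_mset_commute)
    then have "0 < f (add_mset i M)"
      using polar_eq_0[of f "add_mset i M", OF f_add] f_nonneg[of "add_mset i M"] by (metis less_irrefl order_le_less)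
    then show "0 < polar f N (add_mset i (add_mset y M)) (Suc e)"
      by (metis polar_pos f_y add_mset_commute)
  qed (use yN in \<open>simp_all add: polar_nonneg add_mset_commute\<close>)
qed

end

section \<open>Quadratic forms on a set split into fibres\<close>

lemma sum_square_fibres:
  fixes z :: "'a \<Rightarrow> real"
  assumes "finite C"
  shows "(\<Sum>x\<in>C. \<Sum>y\<in>C. if g x = g y then z x * z y else 0)
    = (\<Sum>c\<in>g ` C. (\<Sum>x | x \<in> C \<and> g x = c. z x)\<^sup>2)"
proof -
  define Y where "Y c = (\<Sum>x | x \<in> C \<and> g x = c. z x)" for c
  have "(\<Sum>y\<in>C. if g x = g y then z x * z y else 0) = z x * Y (g x)" for x
  proof -
    have "(\<Sum>y\<in>C. if g x = g y then z x * z y else 0) = (\<Sum>y | y \<in> C \<and> g x = g y. z x * z y)"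
      by (rule sum.inter_filter[OF assms, symmetric])
    then show ?thesis by (simp add: Y_def sum_distrib_left eq_commute)
  qed
  then have "(\<Sum>x\<in>C. \<Sum>y\<in>C. if g x = g y then z x * z y else 0) = (\<Sum>x\<in>C. z x * Y (g x))"
    by simp
  also have "\<dots> = (\<Sum>c\<in>g ` C. \<Sum>x | x \<in> C \<and> g x = c. z x * Y (g x))"
    by (rule sum.image_gen[OF assms])
  also have "\<dots> = (\<Sum>c\<in>g ` C. (Y c)\<^sup>2)"
    by (intro sum.cong refl) (simp add: Y_def power2_eq_square sum_distrib_right)
  finally show ?thesis by (simp add: Y_def)
qed

text \<open>The double sum is \<open>L^2 - Q\<close>, where \<open>Q\<close> adds up the squares of
  the fibre sums. Cauchy-Schwarz over at most \<open>p\<close> fibres gives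
  \<open>L^2 \<le> p * Q\<close>, which rearranges to the factor \<open>p / (p - 1)\<close>; the
  factor 1 needs only \<open>Q \<ge> 0\<close>.\<close>

lemma sum_distinct_fibres_le:
  fixes z :: "'a \<Rightarrow> real"
  assumes fin: "finite C"
    and \<rho>: "\<rho> = 1 \<or> 1 < p \<and> card (g ` C) \<le> p \<and> \<rho> = real p / (real p - 1)"
  shows "\<rho> * (\<Sum>x\<in>C. \<Sum>y\<in>C. if g x \<noteq> g y then z x * z y else 0) \<le> (\<Sum>x\<in>C. z x)\<^sup>2"
proof -
  define Q where "Q = (\<Sum>c\<in>g ` C. (\<Sum>x | x \<in> C \<and> g x = c. z x)\<^sup>2)"
  define L where "L = (\<Sum>x\<in>C. z x)"
  have "L\<^sup>2 = (\<Sum>x\<in>C. \<Sum>y\<in>C. z x * z y)"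
    by (simp add: L_def power2_eq_square sum_product)
  also have "\<dots> = (\<Sum>x\<in>C. \<Sum>y\<in>C. if g x \<noteq> g y then z x * z y else 0)
      + (\<Sum>x\<in>C. \<Sum>y\<in>C. if g x = g y then z x * z y else 0)"
    unfolding sum.distrib[symmetric] by (intro sum.cong) auto
  finally have R: "(\<Sum>x\<in>C. \<Sum>y\<in>C. if g x \<noteq> g y then z x * z y else 0) = L\<^sup>2 - Q"
    by (simp add: sum_square_fibres[OF fin] Q_def)
  have "0 \<le> Q" unfolding Q_def by (intro sum_nonneg) auto
  show ?thesis
  proof (cases "\<rho> = 1")
    case True
    then show ?thesis using R \<open>0 \<le> Q\<close> by (simp add: L_def[symmetric])
  next
    case False
    with \<rho> have p: "1 < p" "card (g ` C) \<le> p" "\<rho> = real p / (real p - 1)" by auto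
    have "L\<^sup>2 \<le> Q * real (card (g ` C))"
      unfolding L_def Q_def sum.image_gen[OF fin, of z g] by (rule sum_squared_le_sum_of_squares)
    also have "\<dots> \<le> Q * real p"
      using p \<open>0 \<le> Q\<close> by (intro mult_left_mono) auto
    finally have *: "real p * (L\<^sup>2 - Q) \<le> L\<^sup>2 * (real p - 1)"
      by (simp add: algebra_simps)
    have "\<rho> * (L\<^sup>2 - Q) = real p * (L\<^sup>2 - Q) / (real p - 1)"
      by (simp add: p(3))
    also have "\<dots> \<le> L\<^sup>2"
      using p(1) * by (subst pos_divide_le_eq) auto
    finally have "\<rho> * (L\<^sup>2 - Q) \<le> L\<^sup>2" .
    then show ?thesis by (simp only: R L_def)
  qed
qed

section \<open>The homogenised independence polynomial as a tensor\<close>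

definition ground_part :: "'e option multiset \<Rightarrow> 'e set" where
  "ground_part M = {x. Some x \<in># M}"

text \<open>The polynomial is square-free in the ground variables, while \<open>None\<close> may
  occur with any multiplicity.\<close>

definition indep_mset :: "'e set set \<Rightarrow> 'e option multiset \<Rightarrow> bool" where
  "indep_mset I M \<longleftrightarrow> (\<forall>x. count M (Some x) \<le> 1) \<and> ground_part M \<in> I"

text \<open>The coefficients of the homogenised independence polynomial with weight \<open>w j\<close> on independent
  sets of size \<open>j\<close>; \<open>None\<close> is the homogenising variable, evaluated at \<open>\<epsilon>\<close>.\<close>

definition indep_tensor :: "'e set set \<Rightarrow> (nat \<Rightarrow> real) \<Rightarrow> real \<Rightarrow> 'e option multiset \<Rightarrow> real" where
  "indep_tensor I w \<epsilon> M =
    (if indep_mset I M then \<epsilon> ^ count M None * w (card (ground_part M)) else 0)"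

lemma ground_part_simps [simp]:
  "ground_part {#} = {}"
  "ground_part (add_mset None M) = ground_part M"
  "ground_part (add_mset (Some x) M) = insert x (ground_part M)"
  by (auto simp: ground_part_def)

lemma finite_ground_part [simp]: "finite (ground_part M)"
proof -
  have "Some ` ground_part M \<subseteq> set_mset M" by (auto simp: ground_part_def)
  then have "finite (Some ` ground_part M)" by (rule finite_subset) simp
  then show ?thesis by (rule finite_imageD) simp
qed

lemma card_ground_part_le: "card (ground_part M) \<le> size M"
proof (induction M)
  case (add a M)
  then show ?case by (cases a) (auto simp: card_insert_if)
qed simp

lemma indep_mset_add_None [simp]: "indep_mset I (add_mset None M) \<longleftrightarrow> indep_mset I M"
  by (simp add: indep_mset_def)

lemma indep_tensor_add_None [simp]: "indep_tensor I w \<epsilon> (add_mset None M) = \<epsilon> * indep_tensor I w \<epsilon> M"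
  by (simp add: indep_tensor_def)

lemma polar_indep_tensor_add_None:
  "polar (indep_tensor I w \<epsilon>) N (add_mset None M) e = \<epsilon> * polar (indep_tensor I w \<epsilon>) N M e"
proof (induction e arbitrary: M)
  case (Suc e)
  then show ?case
    by (simp add: sum_distrib_left add_mset_commute[of _ None])
qed simp

text \<open>The spectral argument needs a positive factor on \<open>None\<close>, whereas the counts
  of independent sets appear at \<epsilon> = 0; this limit connects the two.\<close>

lemma tendsto_polar_indep_tensor:
  "((\<lambda>\<epsilon>. polar (indep_tensor I w \<epsilon>) N M e) \<longlongrightarrow> polar (indep_tensor I w 0) N M e) (at_right 0)"
proof (induction e arbitrary: M)
  case 0
  have "((\<lambda>\<epsilon> :: real. \<epsilon> ^ count M None * w (card (ground_part M)))
      \<longlongrightarrow> 0 ^ count M None * w (card (ground_part M))) (at_right 0)"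
    by (intro tendsto_mult tendsto_power tendsto_const tendsto_ident_at)
  then show ?case
    by (cases "indep_mset I M") (simp_all add: indep_tensor_def)
next
  case (Suc e)
  then show ?case by (simp add: tendsto_sum)
qed

lemma sum_option: "finite X \<Longrightarrow> (\<Sum>a\<in>insert None (Some ` X). g a) = g None + (\<Sum>x\<in>X. g (Some x))"
  by (subst sum.insert) (auto simp: sum.reindex)

section \<open>Parallel classes and the forms of degree 2 of a matroid\<close>

context
  fixes X :: "'e set" and I :: "'e set set"
  assumes matroid: "is_matroid (X, I)"
begin

lemma finite_ground: "finite X"
  and indep_subset: "S \<in> I \<Longrightarrow> S \<subseteq> X"
  and empty_indep: "{} \<in> I"
  and indep_down: "T \<in> I \<Longrightarrow> S \<subseteq> T \<Longrightarrow> S \<in> I"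
  and augment: "S \<in> I \<Longrightarrow> T \<in> I \<Longrightarrow> card S < card T \<Longrightarrow> \<exists>x\<in>T - S. insert x S \<in> I"
  using matroid unfolding is_matroid_def fst_conv snd_conv by blast+

lemma indep_mset_add_Some:
  "indep_mset I (add_mset (Some x) M) \<longleftrightarrow>
    indep_mset I M \<and> x \<notin> ground_part M \<and> insert x (ground_part M) \<in> I"
proof -
  have x: "x \<notin> ground_part M \<longleftrightarrow> count M (Some x) = 0"
    by (simp add: ground_part_def not_in_iff)
  have "(\<forall>u. count (add_mset (Some x) M) (Some u) \<le> 1) \<longleftrightarrow>
      (\<forall>u. count M (Some u) \<le> 1) \<and> x \<notin> ground_part M"
  proof
    assume L: "\<forall>u. count (add_mset (Some x) M) (Some u) \<le> 1"
    have "count M (Some u) \<le> 1" for u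
      using L[rule_format, of u] by (simp split: if_splits)
    moreover have "count M (Some x) = 0"
      using L[rule_format, of x] by simp
    ultimately show "(\<forall>u. count M (Some u) \<le> 1) \<and> x \<notin> ground_part M"
      using x by blast
  qed (simp add: x)
  then show ?thesis
    using indep_down[of "insert x (ground_part M)" "ground_part M"]
    by (auto simp: indep_mset_def)
qed

lemma indep_tensor_add_eq_0:
  "indep_tensor I w \<epsilon> (add_mset a M) = 0"
  if "\<And>j. w j \<noteq> 0" "indep_tensor I w \<epsilon> M = 0"
proof (cases a)
  case (Some x)
  then show ?thesis using that
    by (auto simp: indep_tensor_def indep_mset_add_Some split: if_splits)
qed (use that in simp)

text \<open>Being equal or not jointly independent over \<open>S\<close> is an equivalence relation
  on \<open>C\<close>: parallelism in the contraction by \<open>S\<close>. The pairs on the left are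
  those in different classes, and the hypothesis on \<rho>, applied to a transversal
  \<open>R\<close>, bounds the number of classes.\<close>

lemma contraction_parallel_classes_le:
  assumes S: "S \<in> I" and C_def: "C = {x \<in> X - S. insert x S \<in> I}"
    and \<rho>: "\<rho> = 1 \<or> 1 < p \<and> \<rho> = real p / (real p - 1) \<and>
      (\<forall>R \<subseteq> C. (\<forall>x\<in>R. \<forall>y\<in>R. x \<noteq> y \<longrightarrow> insert x (insert y S) \<in> I) \<longrightarrow> card R \<le> p)"
  shows "\<rho> * (\<Sum>x\<in>C. \<Sum>y\<in>C. if x \<noteq> y \<and> insert x (insert y S) \<in> I then z x * z y else 0)
    \<le> (\<Sum>x\<in>C. z x)\<^sup>2"
proof -
  have fin: "finite C" "finite S" and SC: "S \<inter> C = {}"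
    using finite_ground indep_subset[OF S] by (auto simp: C_def dest: finite_subset)
  define par where "par x y \<longleftrightarrow> x = y \<or> insert x (insert y S) \<notin> I" for x y
  define g where "g x = {u \<in> C. par x u}" for x
  have par_trans: "par x v" if "par x u" "par u v" "x \<in> C" "u \<in> C" "v \<in> C" for x u v
  proof (rule ccontr)
    assume "\<not> par x v"
    then have xv: "x \<noteq> v" "insert x (insert v S) \<in> I" by (auto simp: par_def)
    \<comment> \<open>Augmenting \<open>insert u S\<close> from the larger set adds \<open>x\<close>
      or \<open>v\<close>, against the parallelism of \<open>u\<close> with both.\<close>
    have "card (insert u S) < card (insert x (insert v S))"
    proof -
      have "x \<notin> S" "u \<notin> S" "v \<notin> S"
        using that SC by auto
      then show ?thesis using xv fin by simp
    qed
    then obtain t where t: "t \<in> insert x (insert v S) - insert u S" "insert t (insert u S) \<in> I"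
      using augment[of "insert u S" "insert x (insert v S)"] xv(2) \<open>u \<in> C\<close> unfolding C_def by blast
    then have "t = x \<or> t = v" by auto
    then show False
      using t that(1,2) unfolding par_def by (metis insert_commute insertI1 DiffD2)
  qed
  have par_sym: "par x u \<longleftrightarrow> par u x" for x u
    unfolding par_def insert_commute[of x u] by blast
  have g: "g x = g u \<longleftrightarrow> par x u" if x: "x \<in> C" and u: "u \<in> C" for x u
  proof
    assume "g x = g u"
    moreover have "u \<in> g u"
      using u by (simp add: g_def par_def)
    ultimately have "u \<in> g x"
      by (simp only:)
    then show "par x u"
      by (simp add: g_def)
  next
    assume xu: "par x u"
    then have ux: "par u x" by (simp only: par_sym)
    have "par x v \<longleftrightarrow> par u v" if "v \<in> C" for v
      using par_trans[OF xu _ x u that] par_trans[OF ux _ u x that] by blast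
    then show "g x = g u"
      unfolding g_def by blast
  qed
  have "\<rho> = 1 \<or> 1 < p \<and> card (g ` C) \<le> p \<and> \<rho> = real p / (real p - 1)"
  proof -
    obtain R where R: "R \<subseteq> C" "inj_on g R" "g ` C = g ` R"
      using subset_image_inj[THEN iffD1, OF order_refl] by metis
    have "insert x (insert y S) \<in> I" if "x \<in> R" "y \<in> R" "x \<noteq> y" for x y
    proof -
      have "g x \<noteq> g y" using inj_onD[OF R(2) _ that(1,2)] that(3) by blast
      moreover have "x \<in> C" "y \<in> C" using R(1) that by auto
      ultimately show ?thesis by (simp add: g par_def)
    qed
    then have RI: "\<forall>x\<in>R. \<forall>y\<in>R. x \<noteq> y \<longrightarrow> insert x (insert y S) \<in> I"
      by blast
    have card: "card (g ` C) = card R"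
      using R by (simp add: card_image)
    from \<rho> show ?thesis
    proof (elim disjE conjE)
      assume "1 < p" "\<rho> = real p / (real p - 1)" and le: "\<forall>R\<subseteq>C.
        (\<forall>x\<in>R. \<forall>y\<in>R. x \<noteq> y \<longrightarrow> insert x (insert y S) \<in> I) \<longrightarrow> card R \<le> p"
      moreover have "card R \<le> p"
        using le R(1) RI by simp
      ultimately show ?thesis by (simp add: card)
    qed simp
  qed
  from sum_distinct_fibres_le[OF fin(1) this, of z]
  have "\<rho> * (\<Sum>x\<in>C. \<Sum>y\<in>C. if g x \<noteq> g y then z x * z y else 0) \<le> (\<Sum>x\<in>C. z x)\<^sup>2" .
  moreover have "(\<Sum>x\<in>C. \<Sum>y\<in>C. if g x \<noteq> g y then z x * z y else 0)
      = (\<Sum>x\<in>C. \<Sum>y\<in>C. if x \<noteq> y \<and> insert x (insert y S) \<in> I then z x * z y else 0)"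
    by (intro sum.cong refl) (simp only: g par_def de_Morgan_disj not_not)
  ultimately show ?thesis by simp
qed

text \<open>At \<epsilon> = 0 every summand with \<open>None\<close> drops out. What remains adds
  new elements one by one, and each independent superset is reached in \<open>fact e\<close>
  orders.\<close>

lemma polar_indep_tensor_0:
  assumes w: "\<And>j. w j \<noteq> 0" and M: "indep_mset I M" "None \<notin># M"
  shows "polar (indep_tensor I w 0) (insert None (Some ` X)) M e
    = fact e * w (card (ground_part M) + e)
      * real (card {U \<in> I. ground_part M \<subseteq> U \<and> card U = card (ground_part M) + e})"
  using M
proof (induction e arbitrary: M)
  case 0
  then have "ground_part M \<in> I" by (simp add: indep_mset_def)
  have "U = ground_part M" if "U \<in> I" "ground_part M \<subseteq> U" "card U = card (ground_part M)" for U
    using card_subset_eq[OF finite_subset[OF indep_subset[OF that(1)] finite_ground] that(2) that(3)[symmetric]]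
    by (rule sym)
  then have "{U \<in> I. ground_part M \<subseteq> U \<and> card U = card (ground_part M)} = {ground_part M}"
    using \<open>ground_part M \<in> I\<close> by blast
  \<comment> \<open>\<open>None\<close> does not occur in \<open>M\<close>, so the power of
    \<epsilon> is \<open>0 ^ 0 = 1\<close>.\<close>
  then show ?case
    using 0 by (simp add: indep_tensor_def not_in_iff)
next
  case (Suc e)
  define S where "S = ground_part M"
  define s where "s = card S"
  define A where "A = {U \<in> I. S \<subseteq> U \<and> card U = s + Suc e}"
  define f where "f = indep_tensor I w 0"
  have SI: "S \<in> I" using Suc.prems by (simp add: S_def indep_mset_def)
  have SX: "S \<subseteq> X" "finite S" using indep_subset[OF SI] finite_ground by (auto dest: finite_subset)
  have finI: "finite I"
    by (rule finite_subset[of _ "Pow X"]) (use finite_ground indep_subset in auto)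
  have f_add: "f (add_mset a K) = 0" if "f K = 0" for a K
    unfolding f_def using w that unfolding f_def by (rule indep_tensor_add_eq_0)
  have step: "polar f (insert None (Some ` X)) (add_mset (Some x) M) e
      = (if x \<in> S then 0 else fact e * w (s + Suc e) * real (card {U \<in> A. x \<in> U}))" for x
  proof (cases "x \<notin> S \<and> insert x S \<in> I")
    case True
    then have "indep_mset I (add_mset (Some x) M)" "None \<notin># add_mset (Some x) M"
      using Suc.prems by (auto simp: indep_mset_add_Some S_def)
    from Suc.IH[OF this]
    have "polar f (insert None (Some ` X)) (add_mset (Some x) M) e = fact e * w (card (insert x S) + e)
        * real (card {U \<in> I. insert x S \<subseteq> U \<and> card U = card (insert x S) + e})"
      by (simp only: f_def S_def ground_part_simps)
    moreover have "card (insert x S) + e = s + Suc e"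
      using True SX by (simp add: s_def)
    moreover have "{U \<in> I. insert x S \<subseteq> U \<and> card U = s + Suc e} = {U \<in> A. x \<in> U}"
      unfolding A_def by blast
    ultimately show ?thesis
      using True by simp
  next
    case False
    then have "f (add_mset (Some x) M) = 0"
      by (auto simp: f_def indep_tensor_def indep_mset_add_Some S_def)
    then have "polar f (insert None (Some ` X)) (add_mset (Some x) M) e = 0"
      by (rule polar_eq_0[rotated]) (rule f_add)
    moreover have "{U \<in> A. x \<in> U} = {}" if "x \<notin> S"
    proof -
      have "insert x S \<notin> I" using False that by blast
      then have "x \<notin> U" if "U \<in> A" for U
        using that indep_down[of U "insert x S"] unfolding A_def by blast
      then show ?thesis by blast
    qed
    ultimately show ?thesis
      by (cases "x \<in> S") (simp_all only: card.empty of_nat_0 mult_zero_right if_True if_False not_False_eq_True)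
  qed
  \<comment> \<open>Double counting of the pairs \<open>x \<in> U\<close>: each \<open>U\<close> in
    \<open>A\<close> has \<open>Suc e\<close> elements outside \<open>S\<close>. This factor turns
    \<open>fact e\<close> into \<open>fact (Suc e)\<close>.\<close>
  have "(\<Sum>x\<in>X - S. card {U \<in> A. x \<in> U}) = Suc e * card A"
  proof (rule sum_multicount)
    show "\<forall>U\<in>A. card {x \<in> X - S. x \<in> U} = Suc e"
    proof
      fix U assume U: "U \<in> A"
      then have "{x \<in> X - S. x \<in> U} = U - S" using indep_subset by (auto simp: A_def)
      then show "card {x \<in> X - S. x \<in> U} = Suc e"
        using U SX by (simp add: A_def card_Diff_subset s_def)
    qed
  qed (use finite_ground finI in \<open>auto simp: A_def\<close>)
  then have "real (\<Sum>x\<in>X - S. card {U \<in> A. x \<in> U}) = real (Suc e * card A)"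
    by (rule arg_cong)
  then have count: "(\<Sum>x\<in>X - S. real (card {U \<in> A. x \<in> U})) = real (Suc e) * real (card A)"
    by (simp only: of_nat_sum of_nat_mult)
  have "polar f (insert None (Some ` X)) M (Suc e)
      = (\<Sum>x\<in>X. polar f (insert None (Some ` X)) (add_mset (Some x) M) e)"
    by (simp only: polar.simps sum_option[OF finite_ground] f_def polar_indep_tensor_add_None
        mult_zero_left add_0_left)
  also have "\<dots> = (\<Sum>x\<in>X - S. fact e * w (s + Suc e) * real (card {U \<in> A. x \<in> U}))"
    unfolding step using finite_ground by (intro sum.mono_neutral_cong_right) auto
  also have "\<dots> = fact e * w (s + Suc e) * (real (Suc e) * real (card A))"
    by (simp only: sum_distrib_left[symmetric] count)
  finally show ?case
    unfolding f_def A_def s_def S_def by (simp only: fact_Suc mult_ac)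
qed

text \<open>For independent \<open>M\<close> the form is a positive multiple of the square of a
  linear form minus a form that is nonnegative by \<open>contraction_parallel_classes_le\<close>; a
  shift along the all-one vector annihilates the linear form. A dependent \<open>M\<close> gives the
  zero form.\<close>

lemma hyperbolic_indep_tensor:
  fixes w :: "nat \<Rightarrow> real"
  assumes w: "\<And>j. 0 < w j" and \<epsilon>: "0 < \<epsilon>" and M: "set_mset M \<subseteq> insert None (Some ` X)"
    and s: "s = card (ground_part M)" "w s = 1" "w (Suc s) = 1"
    and bound: "w (s + 2) = 1 \<or> 1 < p \<and> w (s + 2) = real p / (real p - 1) \<and>
      (\<forall>R \<subseteq> {x \<in> X - ground_part M. insert x (ground_part M) \<in> I}.
        (\<forall>x\<in>R. \<forall>y\<in>R. x \<noteq> y \<longrightarrow> insert x (insert y (ground_part M)) \<in> I) \<longrightarrow> card R \<le> p)"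
  shows "hyperbolic (insert None (Some ` X)) (\<lambda>a b. indep_tensor I w \<epsilon> (add_mset a (add_mset b M)))"
    (is "hyperbolic ?N ?B")
proof (cases "indep_mset I M")
  case False
  then have "\<not> indep_mset I (add_mset a (add_mset b M))" for a b
    by (cases a; cases b) (simp_all add: indep_mset_add_Some)
  then show ?thesis
    by (simp add: hyperbolic_def indep_tensor_def bilin_def)
next
  case True
  define S where "S = ground_part M"
  define C where "C = {x \<in> X - S. insert x S \<in> I}"
  define c where "c = \<epsilon> ^ count M None"
  define r where "r x y \<longleftrightarrow> x \<noteq> y \<and> insert x (insert y S) \<in> I" for x y
  have SI: "S \<in> I" using True by (simp add: S_def indep_mset_def)
  have finS: "finite S" by (simp add: S_def)
  have CX: "C \<subseteq> X" and finC: "finite C" using finite_ground by (auto simp: C_def)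
  have c: "0 < c" using \<epsilon> by (simp add: c_def)
  have sym: "?B a b = ?B b a" for a b
    by (simp add: add_mset_commute)
  have nonneg: "0 \<le> ?B a b" for a b
    using \<epsilon> w by (simp add: indep_tensor_def less_imp_le)
  have B_None: "?B None None = c * \<epsilon>\<^sup>2"
    using True s by (simp add: indep_tensor_def c_def power2_eq_square)
  have B_Some: "?B None (Some x) = (if x \<in> C then c * \<epsilon> else 0)" if "x \<in> X" for x
    using True s that finS
    by (auto simp: indep_tensor_def indep_mset_add_Some c_def C_def S_def[symmetric])
  have B_Some': "?B (Some x) None = (if x \<in> C then c * \<epsilon> else 0)" if "x \<in> X" for x
    using B_Some[OF that] sym by simp
  have B_Some_Some: "?B (Some x) (Some u) = (if x \<in> C \<and> u \<in> C \<and> r x u then c * w (s + 2) else 0)"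
    if "x \<in> X" "u \<in> X" for x u
  proof -
    have "indep_mset I (add_mset (Some x) (add_mset (Some u) M)) \<longleftrightarrow> x \<in> C \<and> u \<in> C \<and> r x u"
      using that True indep_down[of "insert x (insert u S)" "insert x S"]
      by (auto simp: indep_mset_add_Some C_def r_def S_def[symmetric])
    then show ?thesis
      using finS s by (auto simp: indep_tensor_def S_def[symmetric] c_def C_def r_def)
  qed
  note [simp del] = indep_tensor_add_None
  have quadratic: "bilin ?N ?B z z = c * ((\<epsilon> * z None + (\<Sum>x\<in>C. z (Some x)))\<^sup>2
      - ((\<Sum>x\<in>C. z (Some x))\<^sup>2
        - w (s + 2) * (\<Sum>x\<in>C. \<Sum>u\<in>C. if r x u then z (Some x) * z (Some u) else 0)))" for z
  proof -
    have 1: "(\<Sum>x\<in>X. ?B None (Some x) * z None * z (Some x)) = c * \<epsilon> * z None * (\<Sum>x\<in>C. z (Some x))"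
    proof -
      have "(\<Sum>x\<in>X. ?B None (Some x) * z None * z (Some x)) = (\<Sum>x\<in>C. c * \<epsilon> * z None * z (Some x))"
        using CX finite_ground by (intro sum.mono_neutral_cong_right) (auto simp: B_Some)
      then show ?thesis by (simp add: sum_distrib_left)
    qed
    have 2: "(\<Sum>x\<in>X. ?B (Some x) None * z (Some x) * z None) = c * \<epsilon> * z None * (\<Sum>x\<in>C. z (Some x))"
    proof -
      have "(\<Sum>x\<in>X. ?B (Some x) None * z (Some x) * z None) = (\<Sum>x\<in>C. c * \<epsilon> * z None * z (Some x))"
        using CX finite_ground by (intro sum.mono_neutral_cong_right) (auto simp: B_Some')
      then show ?thesis by (simp add: sum_distrib_left)
    qed
    have 3: "(\<Sum>x\<in>X. \<Sum>u\<in>X. ?B (Some x) (Some u) * z (Some x) * z (Some u))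
        = c * w (s + 2) * (\<Sum>x\<in>C. \<Sum>u\<in>C. if r x u then z (Some x) * z (Some u) else 0)"
    proof -
      have "(\<Sum>x\<in>X. \<Sum>u\<in>X. ?B (Some x) (Some u) * z (Some x) * z (Some u))
          = (\<Sum>x\<in>X. \<Sum>u\<in>C. ?B (Some x) (Some u) * z (Some x) * z (Some u))"
        using CX finite_ground
        by (intro sum.cong[OF refl] sum.mono_neutral_right) (auto simp: B_Some_Some)
      also have "\<dots> = (\<Sum>x\<in>C. \<Sum>u\<in>C. ?B (Some x) (Some u) * z (Some x) * z (Some u))"
        using CX finite_ground
        by (intro sum.mono_neutral_right) (auto simp: B_Some_Some subset_iff intro!: sum.neutral)
      also have "\<dots> = (\<Sum>x\<in>C. \<Sum>u\<in>C. c * w (s + 2) * (if r x u then z (Some x) * z (Some u) else 0))"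
        using CX by (intro sum.cong refl) (auto simp: B_Some_Some subset_iff)
      finally show ?thesis by (simp only: sum_distrib_left)
    qed
    show ?thesis
      unfolding bilin_def sum_option[OF finite_ground] sum.distrib 1 2 3 B_None
      by (simp add: power2_eq_square algebra_simps)
  qed
  show ?thesis
    unfolding hyperbolic_def
  proof
    fix z
    \<comment> \<open>The denominator is the value of the linear form at the all-one vector,
      positive because \<epsilon> is; with this shift the linear form vanishes at
      \<open>z'\<close>.\<close>
    define t where "t = - (\<epsilon> * z None + (\<Sum>x\<in>C. z (Some x))) / (\<epsilon> + real (card C))"
    define z' where "z' = (\<lambda>a. z a + t * 1)"
    have "\<epsilon> + real (card C) > 0" using \<epsilon> by (simp add: add_pos_nonneg)
    then have "t * (\<epsilon> + real (card C)) = - (\<epsilon> * z None + (\<Sum>x\<in>C. z (Some x)))"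
      by (simp add: t_def)
    then have "\<epsilon> * z' None + (\<Sum>x\<in>C. z' (Some x)) = 0"
      by (simp add: z'_def algebra_simps sum.distrib)
    moreover have "w (s + 2) * (\<Sum>x\<in>C. \<Sum>u\<in>C. if r x u then z' (Some x) * z' (Some u) else 0)
        \<le> (\<Sum>x\<in>C. z' (Some x))\<^sup>2"
      unfolding r_def using bound
      by (intro contraction_parallel_classes_le[OF SI C_def]) (simp only: C_def S_def)
    ultimately have "bilin ?N ?B z' z' \<le> 0"
      unfolding quadratic using c by (simp add: mult_nonneg_nonpos)
    moreover have "0 \<le> bilin ?N ?B (\<lambda>_. 1) (\<lambda>_. 1)"
      unfolding bilin_def using nonneg by (intro sum_nonneg) auto
    ultimately show "bilin ?N ?B z z * bilin ?N ?B (\<lambda>_. 1) (\<lambda>_. 1) \<le> (bilin ?N ?B z (\<lambda>_. 1))\<^sup>2"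
      unfolding z'_def using sym by (intro reverse_Cauchy_Schwarz[where t = t]) auto
  qed
qed

end

section \<open>Log-concavity under a bound on parallel classes\<close>

text \<open>\<open>bound\<close> limits the parallel classes of every contraction by an independent
  set of size \<open>k - 1\<close> to \<open>p\<close>. One hyperbolic form, tested in the direction
  of \<open>None\<close>, relates three consecutive contractions, which become weighted counts as
  \<epsilon> tends to 0.\<close>

theorem num_indep_ultra_log_concave:
  fixes M :: "'e matroid"
  assumes matroid: "is_matroid M" and k: "1 \<le> k" and p: "1 < p"
    and bound: "\<And>S R. S \<in> snd M \<Longrightarrow> card S = k - 1 \<Longrightarrow> R \<subseteq> fst M - S
      \<Longrightarrow> (\<And>x. x \<in> R \<Longrightarrow> insert x S \<in> snd M)
      \<Longrightarrow> (\<And>x y. x \<in> R \<Longrightarrow> y \<in> R \<Longrightarrow> x \<noteq> y \<Longrightarrow> insert x (insert y S) \<in> snd M) \<Longrightarrow> card R \<le> p"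
  shows "(1 + 1 / real k) * (1 + 1 / (real p - 1))
      * real (num_indep M (k - 1)) * real (num_indep M (k + 1)) \<le> (real (num_indep M k))\<^sup>2"
proof -
  obtain X I where M: "M = (X, I)" by (cases M)
  note mat = matroid[unfolded M]
  define N where "N = insert None (Some ` X)"
  \<comment> \<open>The weight \<open>p / (p - 1) = 1 + 1 / (p - 1)\<close> of size
    \<open>k + 1\<close> is the source of the second factor; sizes up to \<open>k\<close> have
    weight 1.\<close>
  define w :: "nat \<Rightarrow> real" where "w j = (if j \<le> k then 1 else real p / (real p - 1))" for j
  define P where "P \<epsilon> j = polar (indep_tensor I w \<epsilon>) N {#} j" for \<epsilon> j
  have w: "0 < w j" for j using p by (simp add: w_def)
  have finN: "finite N" using finite_ground[OF mat] by (simp add: N_def)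
  have pos: "P \<epsilon> (k - 1) * P \<epsilon> (k + 1) \<le> (P \<epsilon> k)\<^sup>2" if \<epsilon>: "0 < \<epsilon>" for \<epsilon>
  proof -
    let ?f = "indep_tensor I w \<epsilon>"
    let ?B = "\<lambda>a b. polar ?f N (add_mset a (add_mset b {#})) (k - 1)"
    have "hyperbolic N ?B"
    proof (rule hyperbolic_polar[OF finN, where y = None and d = "k - 1"])
      fix K :: "'e option multiset" assume K: "set_mset K \<subseteq> N" "size K = k - 1"
      let ?S = "ground_part K"
      have s: "card ?S \<le> k - 1" using card_ground_part_le[of K] K by simp
      show "hyperbolic N (\<lambda>a b. ?f (add_mset a (add_mset b K)))"
      proof (cases "?S \<in> I")
        case False
        have "\<not> indep_mset I (add_mset a (add_mset b K))" for a b
          using False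
          by (cases a; cases b)
            (simp_all add: indep_mset_add_Some[OF mat], simp_all add: indep_mset_def)
        then show ?thesis
          by (simp add: hyperbolic_def indep_tensor_def bilin_def)
      next
        case True
        \<comment> \<open>\<open>K\<close> has size \<open>k - 1\<close>, so
          \<open>card ?S + 2\<close> exceeds \<open>k\<close> only if \<open>K\<close> consists of
          \<open>k - 1\<close> distinct ground elements; there \<open>bound\<close> applies.\<close>
        have "w (card ?S + 2) = 1 \<or> card ?S = k - 1"
          using s by (auto simp: w_def)
        moreover have "w (card ?S + 2) = real p / (real p - 1)" if "card ?S = k - 1"
          using that k by (simp add: w_def)
        moreover have "card R \<le> p"
          if "card ?S = k - 1" "R \<subseteq> {x \<in> X - ?S. insert x ?S \<in> I}"
            "\<forall>x\<in>R. \<forall>y\<in>R. x \<noteq> y \<longrightarrow> insert x (insert y ?S) \<in> I" for R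
          using that True by (intro bound[of ?S R]) (auto simp: M)
        ultimately show ?thesis
          unfolding N_def using w \<epsilon> p K s k
          by (intro hyperbolic_indep_tensor[OF mat, where p = p, OF _ _ _ refl])
            (auto simp: N_def w_def)
      qed
    next
      show "?f (add_mset a K) = 0" if "?f K = 0" for a K
        using w that by (intro indep_tensor_add_eq_0[OF mat]) (auto simp: less_imp_neq[symmetric])
    qed (use w \<epsilon> in \<open>auto simp: N_def indep_tensor_def[of I w \<epsilon>] less_imp_le\<close>)
    \<comment> \<open>The direction of \<open>None\<close>: each slot filled with it extracts a
      factor \<epsilon> and lowers the degree by one, so the three values of the form involve
      \<open>P\<close> at \<open>k - 1\<close>, \<open>k\<close> and \<open>k + 1\<close>.\<close>
    define z :: "'e option \<Rightarrow> real" where "z = (\<lambda>a. if a = None then 1 else 0)"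
    have NN: "None \<in> N" by (simp add: N_def)
    have "bilin N ?B z z = ?B None None"
      using finN NN by (simp add: bilin_def z_def if_distrib[of "\<lambda>x. _ * x"] sum.delta cong: if_cong)
    also have "\<dots> = \<epsilon>\<^sup>2 * P \<epsilon> (k - 1)"
      by (simp add: polar_indep_tensor_add_None P_def power2_eq_square)
    finally have 1: "bilin N ?B z z = \<epsilon>\<^sup>2 * P \<epsilon> (k - 1)" .
    have Sk: "Suc (k - 1) = k" using k by simp
    have "bilin N ?B z (\<lambda>_. 1) = (\<Sum>b\<in>N. ?B None b)"
      using finN NN unfolding bilin_def
      by (subst sum.swap) (simp add: z_def if_distrib[of "\<lambda>x. _ * x"] sum.delta cong: if_cong)
    also have "\<dots> = \<epsilon> * polar ?f N {#} (Suc (k - 1))"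
      by (simp add: polar_indep_tensor_add_None sum_distrib_left)
    finally have 2: "bilin N ?B z (\<lambda>_. 1) = \<epsilon> * P \<epsilon> k"
      unfolding Sk P_def .
    have "bilin N ?B (\<lambda>_. 1) (\<lambda>_. 1) = polar ?f N {#} (Suc (Suc (k - 1)))"
      by (simp add: bilin_def add_mset_commute)
    then have 3: "bilin N ?B (\<lambda>_. 1) (\<lambda>_. 1) = P \<epsilon> (k + 1)"
      unfolding Sk P_def by simp
    have "\<epsilon>\<^sup>2 * P \<epsilon> (k - 1) * P \<epsilon> (k + 1) \<le> (\<epsilon> * P \<epsilon> k)\<^sup>2"
      using \<open>hyperbolic N ?B\<close> unfolding hyperbolic_def 1[symmetric] 2[symmetric] 3[symmetric] by blast
    then have "\<epsilon>\<^sup>2 * (P \<epsilon> (k - 1) * P \<epsilon> (k + 1)) \<le> \<epsilon>\<^sup>2 * (P \<epsilon> k)\<^sup>2"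
      by (simp add: power_mult_distrib mult.assoc)
    then show ?thesis using \<epsilon> by simp
  qed
  have lim: "((\<lambda>\<epsilon>. P \<epsilon> j) \<longlongrightarrow> P 0 j) (at_right 0)" for j
    unfolding P_def by (rule tendsto_polar_indep_tensor)
  have "P 0 (k - 1) * P 0 (k + 1) \<le> (P 0 k)\<^sup>2"
    by (rule tendsto_le[OF _ tendsto_power[OF lim] tendsto_mult[OF lim lim]])
      (use pos in \<open>auto intro: eventually_mono[OF eventually_at_right_less]\<close>)
  moreover have "P 0 j = fact j * w j * real (num_indep M j)" for j
  proof -
    have "indep_mset I {#}" using empty_indep[OF mat] by (simp add: indep_mset_def)
    moreover have "w i \<noteq> 0" for i using w[of i] by simp
    ultimately show ?thesis
      using polar_indep_tensor_0[OF mat, of w "{#}" j] by (simp add: P_def N_def num_indep_def M)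
  qed
  ultimately have main: "fact (k - 1) * real (num_indep M (k - 1))
      * (fact (k + 1) * (real p / (real p - 1)) * real (num_indep M (k + 1)))
      \<le> (fact k * real (num_indep M k))\<^sup>2"
    by (simp add: w_def)
  obtain l where l: "k = Suc l" using k by (cases k) auto
  define F :: real where "F = (fact k)\<^sup>2"
  have "F > 0" by (simp add: F_def)
  \<comment> \<open>The factorials attached to the counts are the source of the factor
    \<open>1 + 1 / k\<close>.\<close>
  have fact: "fact (k - 1) * fact (k + 1) = F * (1 + 1 / real k)"
    by (simp add: F_def l power2_eq_square field_simps)
  have "F * ((1 + 1 / real k) * (1 + 1 / (real p - 1))
      * real (num_indep M (k - 1)) * real (num_indep M (k + 1)))
      = (fact (k - 1) * fact (k + 1)) * (real p / (real p - 1))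
      * real (num_indep M (k - 1)) * real (num_indep M (k + 1))"
    unfolding fact using p by (simp add: field_simps)
  also have "\<dots> \<le> F * (real (num_indep M k))\<^sup>2"
    using main by (simp add: F_def power_mult_distrib mult_ac)
  finally show ?thesis
    using \<open>F > 0\<close> by simp
qed

section \<open>Counting cosets over a finite field\<close>

text \<open>The cosets of \<open>span S\<close> through \<open>0\<close> and through the elements of \<open>R\<close> are pairwise disjoint.\<close>

lemma card_parallel_representatives:
  fixes S R :: "('a::{field,finite} ^ 'm) set"
  assumes S: "vec.independent S"
    and R: "\<And>x. x \<in> R \<Longrightarrow> x \<notin> vec.span S"
    and RR: "\<And>x y. x \<in> R \<Longrightarrow> y \<in> R \<Longrightarrow> x \<noteq> y \<Longrightarrow> x \<notin> vec.span (insert y S)"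
  shows "(card R + 1) * CARD('a) ^ card S \<le> CARD('a) ^ CARD('m)"
proof -
  \<comment> \<open>Points of the cosets are given by a representative and coefficients, which are
    unique as \<open>S\<close> is independent. The representative 0 stands for
    \<open>vec.span S\<close> itself, whence the \<open>+ 1\<close>.\<close>
  define h where "h = (\<lambda>(r, c). r + (\<Sum>s\<in>S. c s *s s) :: 'a ^ 'm)"
  let ?D = "insert 0 R \<times> (S \<rightarrow>\<^sub>E (UNIV :: 'a set))"
  have finS: "finite S" by simp
  have span: "(\<Sum>s\<in>S. c s *s s) \<in> vec.span S" for c :: "'a ^ 'm \<Rightarrow> 'a"
    by (intro vec.span_sum vec.span_scale vec.span_base)
  have disjoint: "r = r'" if "r \<in> insert 0 R" "r' \<in> insert 0 R" and d: "r - r' \<in> vec.span S" for r r'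
  proof (rule ccontr)
    assume "r \<noteq> r'"
    have "r' - r \<in> vec.span S"
      using vec.span_neg[OF d] by simp
    then have "r \<in> R \<Longrightarrow> r' \<in> R"
      using R[of r] d that by auto
    moreover have "r' \<in> R \<Longrightarrow> r \<in> R"
      using R[of r'] \<open>r' - r \<in> vec.span S\<close> that by auto
    ultimately have "r \<in> R" "r' \<in> R"
      using that \<open>r \<noteq> r'\<close> by auto
    moreover have "(r - r') + r' \<in> vec.span (insert r' S)"
      using d by (intro vec.span_add) (auto intro: vec.span_base vec.span_mono[THEN subsetD])
    ultimately show False
      using RR[of r r'] \<open>r \<noteq> r'\<close> by simp
  qed
  have "inj_on h ?D"
  proof (rule inj_onI, clarify)
    fix r c r' c'
    assume r: "r \<in> insert 0 R" "r' \<in> insert 0 R"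
      and c: "c \<in> S \<rightarrow>\<^sub>E (UNIV :: 'a set)" "c' \<in> S \<rightarrow>\<^sub>E UNIV" and "h (r, c) = h (r', c')"
    then have eq: "r + (\<Sum>s\<in>S. c s *s s) = r' + (\<Sum>s\<in>S. c' s *s s)" by (simp add: h_def)
    then have "r - r' = (\<Sum>s\<in>S. c' s *s s) - (\<Sum>s\<in>S. c s *s s)"
      by (simp add: algebra_simps)
    then have "r - r' \<in> vec.span S"
      using vec.span_diff[OF span span] by simp
    then have "r = r'" by (rule disjoint[OF r])
    with eq have "(\<Sum>s\<in>S. (c s - c' s) *s s) = 0"
      by (simp add: vec.scale_left_diff_distrib sum_subtractf)
    then have "c s - c' s = 0" if "s \<in> S" for s
      using vec.independentD[OF S finS order_refl _ that, of "\<lambda>s. c s - c' s"] by simp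
    then have "c = c'"
      using c by (intro PiE_ext) auto
    with \<open>r = r'\<close> show "r = r' \<and> c = c'" by simp
  qed
  then have "card ?D \<le> card (UNIV :: ('a ^ 'm) set)"
    by (intro card_inj_on_le[of h]) auto
  moreover have "0 \<notin> R"
    using R vec.span_zero by blast
  ultimately show ?thesis
    by (simp add: card_cartesian_product card_funcsetE)
qed

theorem corollary1p13:
  fixes X :: "('a::{field,finite} ^ 'm) set" and M :: "('a ^ 'm) matroid"
    and q m n k :: nat
  assumes "CARD('a) = q" and "CARD('m) = m"
    and "card X = n" and "vec.span X = UNIV"
    and "M = linear_matroid X"
    and "1 \<le> k" and "k < m"
  shows "(real (num_indep M k))\<^sup>2 \<ge>
           (1 + 1 / real k) * (1 + 1 / (real q ^ (m - k + 1) - 2))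
             * real (num_indep M (k - 1)) * real (num_indep M (k + 1))"
proof -
  \<comment> \<open>For independent \<open>S\<close> of size \<open>k - 1\<close> the quotient by
    \<open>vec.span S\<close> has dimension \<open>m - k + 1\<close>; \<open>p\<close> counts its
    nonzero vectors, that is, the cosets available to representatives of parallel classes.\<close>
  define p where "p = q ^ (m - k + 1) - 1"
  have "card {0, 1 :: 'a} \<le> q"
    unfolding assms(1)[symmetric] by (intro card_mono) auto
  then have q: "2 \<le> q" by simp
  \<comment> \<open>\<open>k < m\<close> makes the exponent at least 2, which is what yields
    \<open>1 < p\<close>.\<close>
  have "(2 :: nat) ^ 2 \<le> 2 ^ (m - k + 1)"
    using assms(7) by (intro power_increasing) auto
  also have "\<dots> \<le> q ^ (m - k + 1)"
    using q by (intro power_mono) auto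
  finally have "4 \<le> q ^ (m - k + 1)" by simp
  then have "1 < p" "p + 1 = q ^ (m - k + 1)"
    unfolding p_def by auto
  moreover from this(2) have "real p + 1 = real q ^ (m - k + 1)"
    by (metis of_nat_1 of_nat_add of_nat_power)
  ultimately have p: "1 < p" "real p - 1 = real q ^ (m - k + 1) - 2"
    by simp_all
  have "card R \<le> p"
    if S: "S \<in> snd M" "card S = k - 1" and R: "R \<subseteq> fst M - S"
      and indep: "\<And>x. x \<in> R \<Longrightarrow> insert x S \<in> snd M"
        "\<And>x y. x \<in> R \<Longrightarrow> y \<in> R \<Longrightarrow> x \<noteq> y \<Longrightarrow> insert x (insert y S) \<in> snd M" for S R
  proof -
    have notin: "x \<notin> vec.span T" if "vec.independent (insert x T)" "x \<notin> T" for x and T :: "('a ^ 'm) set"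
      using that by (simp add: vec.independent_insert)
    have "(card R + 1) * CARD('a) ^ card S \<le> CARD('a) ^ CARD('m)"
    proof (rule card_parallel_representatives)
      show "vec.independent S"
        using S by (simp add: assms(5) linear_matroid_def)
      show "x \<notin> vec.span S" if "x \<in> R" for x
        using indep(1)[OF that] R that by (intro notin) (auto simp: assms(5) linear_matroid_def)
      show "x \<notin> vec.span (insert y S)" if "x \<in> R" "y \<in> R" "x \<noteq> y" for x y
        using indep(2)[OF that] R that by (intro notin) (auto simp: assms(5) linear_matroid_def)
    qed
    also have "CARD('a) ^ CARD('m) = q ^ (m - k + 1) * q ^ (k - 1)"
    proof -
      have "m - k + 1 + (k - 1) = m" using assms(6,7) by simp
      then show ?thesis
        unfolding assms(1,2) by (simp only: power_add[symmetric])
    qed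
    finally have "(card R + 1) * q ^ (k - 1) \<le> q ^ (m - k + 1) * q ^ (k - 1)"
      by (simp only: assms(1) S(2))
    moreover have "0 < q ^ (k - 1)" using q by simp
    ultimately have "card R + 1 \<le> q ^ (m - k + 1)"
      by (metis mult_le_cancel2)
    then show ?thesis by (simp add: p_def)
  qed
  moreover have "is_matroid M"
    unfolding assms(5) by (rule is_matroid_linear_matroid) simp
  ultimately show ?thesis
    using num_indep_ultra_log_concave[of M k p] assms(6) p by simp
qed

end
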